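(* Let $\mathsf{N}\subset\mathsf{H}$ be a Lagrangian subspace with trivial $\mathsf{N}_\infty=\mathsf{M}^\perp\cap\mathsf{N}$. Let $\mathcal{T}:\mathsf{M}\to\mathsf{M}$ be the corresponding (possibly unbounded, self-adjoint) operator with the graph represented by $\mathsf{N}$, that is, $\mathsf{N}=\{(\mathcal{U}\mathcal{T}x,x)\mid x\in\mathrm{Dom}(\mathcal{T})\}$. Let $\lambda\in\mathbb{R}$. If for some fixed $\varepsilon\in(0,1)$ the intersection $\mathsf{N}^{\varepsilon}\cap\mathsf{N}^{g}$ is non-zero (contains a non-zero vector) for every $g$ from the semigroup $$\mathsf{A}_\lambda=\left\{\begin{pmatrix} e^{t} & \lambda(e^{-t}-e^{t})\\ 0& e^{-t}\end{pmatrix}\;\middle|\; t\in(0,\infty)\right\},$$ then the operator $\mathcal{T}-\lambda\mathbb{1}$ does not have a bounded inverse.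
   Context: Setting. $\mathsf{H}$ is a separable real Hilbert space (finite or infinite dimensional), $\mathsf{M}\subset\mathsf{H}$ is a closed subspace with $\dim\mathsf{M}=\dim\mathsf{M}^\perp$, and $\mathcal{U}:\mathsf{M}\to\mathsf{M}^\perp$ is a fixed unitary (isometric linear bijection). Elements of $\mathsf{H}=\mathsf{M}^\perp\oplus\mathsf{M}$ (orthogonal sum) are written $(y,x)$ with $y\in\mathsf{M}^\perp$, $x\in\mathsf{M}$; $P_{\mathsf{M}}$ is the orthogonal projection onto $\mathsf{M}$. The symplectic form on $\mathsf{H}$ is $\omega((y,x);(y',x'))=\langle \mathcal{U}x,y'\rangle-\langle \mathcal{U}^*y,x'\rangle$. The symplectic complement of a subspace $\mathsf{L}$ is $\mathsf{L}^\circ=\{z\in\mathsf{H}\mid \omega(z;z')=0 \text{ for all } z'\in\mathsf{L}\}$; $\mathsf{L}$ is Lagrangian if $\mathsf{L}=\mathsf{L}^\circ$. For $g=\begin{pmatrix}a&b\\c&d\end{pmatrix}\in\mathrm{SL}_2(\mathbb{R})$ the operator $\mathcal{M}_{\mathcal{U}}(g):\mathsf{H}\to\mathsf{H}$ is $\mathcal{M}_{\mathcal{U}}(g)(y,x)=(ay+b\,\mathcal{U}x,\; c\,\mathcal{U}^*y+dx)$, and $\mathsf{N}^g=\{\mathcal{M}_{\mathcal{U}}(g)z\mid z\in\mathsf{N}\}$. For $\varepsilon\in(0,1)$ the $\varepsilon$-adjunct neighbourhood of a subspace $\mathsf{N}$ is $$\mathsf{N}^{\varepsilon}=\{z+y\mid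 z\in\mathsf{N},\ y\in\mathsf{M}^\perp \text{ and } \|y\|<\varepsilon\|P_{\mathsf{M}}z\|\}.$$ *)

theory Defs
  imports "HOL-Analysis.Analysis"
begin

(* Operators between subspaces are total functions whose values matter only on an explicitly
   given domain.  No boundedness is required, so D is in general not closed. *)
definition operator_on :: "'a::real_inner set \<Rightarrow> 'a set \<Rightarrow> ('a \<Rightarrow> 'a) \<Rightarrow> bool" where
  "operator_on D K T \<longleftrightarrow>
     subspace D \<and> T ` D \<subseteq> K \<and>
     (\<forall>x\<in>D. \<forall>y\<in>D. T (x + y) = T x + T y) \<and>
     (\<forall>r. \<forall>x\<in>D. T (r *\<^sub>R x) = r *\<^sub>R T x)"

definition unitary_between :: "'a::real_inner set \<Rightarrow> 'a set \<Rightarrow> ('a \<Rightarrow> 'a) \<Rightarrow> bool" where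
  "unitary_between M K U \<longleftrightarrow>
     operator_on M K U \<and> bij_betw U M K \<and> (\<forall>x\<in>M. norm (U x) = norm x)"

(* A bounded inverse of an operator S in K with domain D \<subseteq> K is an everywhere defined
   bounded operator B on K that inverts the map S : D \<rightarrow> K on both sides. *)
definition has_bounded_inverse :: "'a::real_inner set \<Rightarrow> 'a set \<Rightarrow> ('a \<Rightarrow> 'a) \<Rightarrow> bool" where
  "has_bounded_inverse K D S \<longleftrightarrow>
     (\<exists>B. operator_on K D B \<and>
          (\<exists>C. \<forall>y\<in>K. norm (B y) \<le> C * norm y) \<and>
          (\<forall>x\<in>D. B (S x) = x) \<and> (\<forall>y\<in>K. S (B y) = y))"

(* The library's closest_point needs a Heine-Borel space, hence finite dimension. *)
definition orth_proj :: "'a::real_inner set \<Rightarrow> 'a \<Rightarrow> 'a" where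
  "orth_proj M z = (THE x. x \<in> M \<and> z - x \<in> M\<^sup>\<bottom>)"

(* The adjoint of U : M \<rightarrow> M\<^sup>\<bottom>, as a map M\<^sup>\<bottom> \<rightarrow> M.  The library's adjoint is for maps
   defined on the whole space. *)
definition adj_on :: "'a::real_inner set \<Rightarrow> ('a \<Rightarrow> 'a) \<Rightarrow> 'a \<Rightarrow> 'a" where
  "adj_on M U y = (THE x. x \<in> M \<and> (\<forall>x'\<in>M. U x' \<bullet> y = x' \<bullet> x))"

(* Here and below the pair (y, x) with y \<in> M\<^sup>\<bottom> and x \<in> M is the vector z = y + x, so that
   x = orth_proj M z and y = orth_proj (M\<^sup>\<bottom>) z. *)
definition symp_form :: "'a::real_inner set \<Rightarrow> ('a \<Rightarrow> 'a) \<Rightarrow> 'a \<Rightarrow> 'a \<Rightarrow> real" where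
  "symp_form M U z z' =
     U (orth_proj M z) \<bullet> orth_proj (M\<^sup>\<bottom>) z' - adj_on M U (orth_proj (M\<^sup>\<bottom>) z) \<bullet> orth_proj M z'"

definition symp_compl :: "'a::real_inner set \<Rightarrow> ('a \<Rightarrow> 'a) \<Rightarrow> 'a set \<Rightarrow> 'a set" where
  "symp_compl M U L = {z. \<forall>z'\<in>L. symp_form M U z z' = 0}"

definition lagrangian :: "'a::real_inner set \<Rightarrow> ('a \<Rightarrow> 'a) \<Rightarrow> 'a set \<Rightarrow> bool" where
  "lagrangian M U L \<longleftrightarrow> subspace L \<and> L = symp_compl M U L"

definition SL2 :: "(real^2^2) set" where
  "SL2 = {g. det g = 1}"

(* Only used for g \<in> SL2. *)
definition sl2_op :: "'a::real_inner set \<Rightarrow> ('a \<Rightarrow> 'a) \<Rightarrow> real^2^2 \<Rightarrow> 'a \<Rightarrow> 'a" where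
  "sl2_op M U g z =
     (let x = orth_proj M z; y = orth_proj (M\<^sup>\<bottom>) z in
       (g$1$1 *\<^sub>R y + g$1$2 *\<^sub>R U x) + (g$2$1 *\<^sub>R adj_on M U y + g$2$2 *\<^sub>R x))"

definition sl2_image :: "'a::real_inner set \<Rightarrow> ('a \<Rightarrow> 'a) \<Rightarrow> real^2^2 \<Rightarrow> 'a set \<Rightarrow> 'a set" where
  "sl2_image M U g N = sl2_op M U g ` N"

definition adjunct_nbhd :: "'a::real_inner set \<Rightarrow> real \<Rightarrow> 'a set \<Rightarrow> 'a set" where
  "adjunct_nbhd M \<epsilon> N =
     {z + y | z y. z \<in> N \<and> y \<in> M\<^sup>\<bottom> \<and> norm y < \<epsilon> * norm (orth_proj M z)}"

definition semigroup_A :: "real \<Rightarrow> (real^2^2) set" where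
  "semigroup_A lam =
     {vector [vector [exp t, lam * (exp (- t) - exp t)],
              vector [0,     exp (- t)]] | t. 0 < t}"

lemma semigroup_A_subset_SL2: "semigroup_A lam \<subseteq> SL2"
  by (auto simp: semigroup_A_def SL2_def det_2 simp flip: exp_add)

end

theory Submission
  imports Defs
begin

text \<open>
  Put \<open>S = T - lam\<close>.  The matrix \<open>g\<close> with parameter \<open>t\<close> scales the graph of \<open>lam\<close> by \<open>exp (- t)\<close>
  and \<open>M\<^sup>\<bottom>\<close> by \<open>exp t\<close>, so it carries the graph of \<open>T = lam + S\<close> to the graph of
  \<open>lam + exp (2 * t) S\<close>.  Over the same point \<open>w\<close> the two graphs differ by
  \<open>(exp (2 * t) - 1) U (S w)\<close> in \<open>M\<^sup>\<bottom>\<close>, and a vector of the image lies in the adjunct neighbourhood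
  exactly when this displacement is shorter than \<open>\<epsilon> \<parallel>w\<parallel>\<close>.  This strict inequality excludes \<open>w = 0\<close>,
  so an intersection for every \<open>t > 0\<close> makes \<open>\<parallel>S w\<parallel> / \<parallel>w\<parallel>\<close> arbitrarily small
  (\<open>adjunct_nbhd_meets_image_imp_small\<close>), whereas a bounded inverse of \<open>S\<close> keeps this quotient
  away from zero.
\<close>

lemma orth_proj_eqI:
  assumes "subspace W" and "x \<in> W" and "z - x \<in> W\<^sup>\<bottom>"
  shows "orth_proj W z = x"
  unfolding orth_proj_def
proof (rule the_equality)
  show "x \<in> W \<and> z - x \<in> W\<^sup>\<bottom>" using assms by blast
next
  fix x' assume x': "x' \<in> W \<and> z - x' \<in> W\<^sup>\<bottom>"
  have "(z - x) - (z - x') \<in> W\<^sup>\<bottom>"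
    using assms(3) x' subspace_diff[OF subspace_orthogonal_comp] by blast
  hence "x' - x \<in> W\<^sup>\<bottom>" by simp
  moreover have "x' - x \<in> W" using x' assms by (simp add: subspace_diff)
  ultimately have "(x' - x) \<bullet> (x' - x) = 0"
    by (auto simp: orthogonal_comp_def orthogonal_def)
  thus "x' = x" by simp
qed

lemma orth_proj_add:
  assumes "subspace M" and "x \<in> M" and "y \<in> M\<^sup>\<bottom>"
  shows "orth_proj M (y + x) = x" and "orth_proj (M\<^sup>\<bottom>) (y + x) = y"
proof -
  show "orth_proj M (y + x) = x"
    using assms by (intro orth_proj_eqI) auto
  have "x \<in> M\<^sup>\<bottom>\<^sup>\<bottom>"
    using assms(2) by (auto simp: orthogonal_comp_def orthogonal_commute)
  thus "orth_proj (M\<^sup>\<bottom>) (y + x) = y"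
    using assms(3) by (intro orth_proj_eqI) (auto simp: subspace_orthogonal_comp)
qed

text \<open>
  The \<open>M\<close>-components of a common vector force its preimage to lie over \<open>exp t * w\<close>, where \<open>w\<close> is the
  base point of the vector of the graph that the neighbourhood displaces; the \<open>M\<^sup>\<bottom>\<close>-components then
  determine the displacement.
\<close>

lemma adjunct_nbhd_meets_image_imp_small:
  fixes M D :: "'a::real_inner set" and U T :: "'a \<Rightarrow> 'a" and t lam \<epsilon> :: real
  defines "g \<equiv> (vector [vector [exp t, lam * (exp (- t) - exp t)],
                        vector [0, exp (- t)]] :: real^2^2)"
    and "N \<equiv> {U (T x) + x | x. x \<in> D}"
  assumes M: "subspace M" and U: "unitary_between M (M\<^sup>\<bottom>) U"
    and D: "D \<subseteq> M" and T: "operator_on D M T"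
    and t: "0 \<le> t"
    and v: "v \<in> adjunct_nbhd M \<epsilon> N \<inter> sl2_image M U g N"
  shows "\<exists>w\<in>D. (exp (2 * t) - 1) * norm (T w - lam *\<^sub>R w) < \<epsilon> * norm w"
proof -
  have Uadd: "U (p + q) = U p + U q" if "p \<in> M" "q \<in> M" for p q
    using U that by (auto simp: unitary_between_def operator_on_def)
  have Uscale: "U (r *\<^sub>R p) = r *\<^sub>R U p" if "p \<in> M" for r p
    using U that by (auto simp: unitary_between_def operator_on_def)
  have UM: "U p \<in> M\<^sup>\<bottom>" and Unorm: "norm (U p) = norm p" if "p \<in> M" for p
    using U that by (auto simp: unitary_between_def operator_on_def)
  have TM: "T p \<in> M" if "p \<in> D" for p
    using T that by (auto simp: operator_on_def)
  have Dsub: "subspace D" and Tscale: "T (r *\<^sub>R p) = r *\<^sub>R T p" if "p \<in> D" for r p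
    using T that by (auto simp: operator_on_def)
  obtain w y where w: "w \<in> D" and y: "y \<in> M\<^sup>\<bottom>"
    and vw: "v = (U (T w) + w) + y"
    and less: "norm y < \<epsilon> * norm (orth_proj M (U (T w) + w))"
    using v unfolding adjunct_nbhd_def N_def by blast
  obtain x where x: "x \<in> D" and vx: "v = sl2_op M U g (U (T x) + x)"
    using v unfolding sl2_image_def N_def by blast
  have wM: "w \<in> M" and xM: "x \<in> M" using w x D by auto
  have perp: "subspace (M\<^sup>\<bottom>)" by (rule subspace_orthogonal_comp)
  define u where "u = exp t *\<^sub>R U (T x) + (lam * (exp (- t) - exp t)) *\<^sub>R U x"
  have uM: "u \<in> M\<^sup>\<bottom>"
    unfolding u_def using perp UM TM x xM by (intro subspace_add subspace_scale) auto
  have v1: "v = u + exp (- t) *\<^sub>R x"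
    unfolding vx sl2_op_def u_def g_def
    using orth_proj_add[OF M xM UM[OF TM[OF x]]] by (simp add: vector_2)
  have v2: "v = (U (T w) + y) + w" using vw by simp
  have yM: "U (T w) + y \<in> M\<^sup>\<bottom>"
    using perp UM TM w y by (intro subspace_add) auto
  have xsM: "exp (- t) *\<^sub>R x \<in> M" using M xM by (simp add: subspace_scale)
  have wx: "w = exp (- t) *\<^sub>R x"
    using orth_proj_add(1)[OF M xsM uM] orth_proj_add(1)[OF M wM yM] v1 v2 by simp
  have yu: "U (T w) + y = u"
    using orth_proj_add(2)[OF M xsM uM] orth_proj_add(2)[OF M wM yM] v1 v2 by simp
  have xw: "x = exp t *\<^sub>R w"
    by (simp add: wx flip: exp_add)
  have "u = exp (2 * t) *\<^sub>R U (T w) + (lam * (1 - exp (2 * t))) *\<^sub>R U w"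
    unfolding u_def xw using w wM TM
    by (simp add: Tscale Uscale algebra_simps flip: exp_add)
  moreover have "y = u - U (T w)" using yu by (simp add: eq_diff_eq add.commute)
  ultimately have "y = exp (2 * t) *\<^sub>R U (T w) + (lam * (1 - exp (2 * t))) *\<^sub>R U w - U (T w)"
    by simp
  also have "\<dots> = (exp (2 * t) - 1) *\<^sub>R (U (T w) + (- lam) *\<^sub>R U w)"
    by (simp add: algebra_simps)
  also have "U (T w) + (- lam) *\<^sub>R U w = U (T w + (- lam) *\<^sub>R w)"
    using M wM TM[OF w] by (simp only: Uadd Uscale subspace_scale)
  finally have "norm y = (exp (2 * t) - 1) * norm (T w - lam *\<^sub>R w)"
    using M wM TM[OF w] t by (simp add: Unorm subspace_diff subspace_scale)
  moreover have "orth_proj M (U (T w) + w) = w"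
    using orth_proj_add(1)[OF M wM UM[OF TM[OF w]]] .
  ultimately show ?thesis using less w by auto
qed

theorem proposition10:
  fixes M N D :: "'a::{real_inner, complete_space} set"
    and U T :: "'a \<Rightarrow> 'a"
    and lam \<epsilon> :: real
  assumes "separable_space (euclidean :: 'a topology)"
    and "subspace M" and "closed M"
    and "unitary_between M (M\<^sup>\<bottom>) U"
    and "lagrangian M U N"
    and "M\<^sup>\<bottom> \<inter> N = {0}"
    and "D \<subseteq> M" and "operator_on D M T"
    and "N = {U (T x) + x | x. x \<in> D}"
    and "0 < \<epsilon>" and "\<epsilon> < 1"
    and "\<And>g. g \<in> semigroup_A lam \<Longrightarrow> \<exists>v. v \<noteq> 0 \<and> v \<in> adjunct_nbhd M \<epsilon> N \<inter> sl2_image M U g N"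
  shows "\<not> has_bounded_inverse M D (\<lambda>x. T x - lam *\<^sub>R x)"
proof
  assume "has_bounded_inverse M D (\<lambda>x. T x - lam *\<^sub>R x)"
  then obtain B C where bound: "\<And>y. y \<in> M \<Longrightarrow> norm (B y) \<le> C * norm y"
    and left_inv: "\<And>x. x \<in> D \<Longrightarrow> B (T x - lam *\<^sub>R x) = x"
    unfolding has_bounded_inverse_def by blast
  \<comment> \<open>any \<open>t > 0\<close> with \<open>exp (2 * t) - 1 \<ge> C\<close> gives the contradiction\<close>
  define t where "t = \<bar>C\<bar> + 1"
  have t: "0 < t" and "C \<le> t" by (auto simp: t_def)
  hence C: "C \<le> exp (2 * t) - 1" using exp_ge_add_one_self[of "2 * t"] by linarith
  obtain v where "v \<in> adjunct_nbhd M \<epsilon> N \<inter> sl2_image M U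
      (vector [vector [exp t, lam * (exp (- t) - exp t)], vector [0, exp (- t)]]) N"
    using assms(12) t unfolding semigroup_A_def by blast
  then obtain w where w: "w \<in> D"
    and less: "(exp (2 * t) - 1) * norm (T w - lam *\<^sub>R w) < \<epsilon> * norm w"
    using adjunct_nbhd_meets_image_imp_small[OF assms(2,4,7,8)] t
    unfolding assms(9) by (meson less_imp_le)
  have "T w - lam *\<^sub>R w \<in> M"
    using assms(2,7,8) w by (auto simp: operator_on_def intro!: subspace_diff subspace_scale)
  hence "norm w \<le> C * norm (T w - lam *\<^sub>R w)"
    using bound left_inv[OF w] by metis
  also have "\<dots> \<le> (exp (2 * t) - 1) * norm (T w - lam *\<^sub>R w)"
    using C by (intro mult_right_mono) auto
  also have "\<dots> < \<epsilon> * norm w" by (rule less)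
  also have "\<dots> \<le> norm w"
    using assms(11) by (intro mult_left_le_one_le) (use assms(10) in auto)
  finally show False by simp
qed

end
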